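(* Let $X$ be a compact Hausdorff topological space, let $n\geq 1$, and let $\xi_1,\ldots,\xi_n$ be $n$ finite-dimensional real vector bundles over $X$. Suppose that $(U_i)_{i\in I}$ is a finite open cover of $X$ such that each point of $X$ lies in $U_i$ for at most $n$ indices $i\in I$. Suppose that for each $i\in I$ and each $k\in\{1,\ldots,n\}$ there exists a (global, continuous) section of $\xi_k$ over $X$ with no zeros in $U_i$. Then $\xi=\xi_1\oplus\cdots\oplus\xi_n$ admits a global nowhere zero section.
   Context: All sections are continuous. A zero of a section $s$ of a vector bundle over $X$ is a point $x\in X$ with $s(x)=0$ in the fibre at $x$. A section is nowhere zero if it has no zeros. *)

theory Defs
  imports "HOL-Analysis.Analysis"
begin

locale real_vector_space_on =
  fixes V :: "'v set"
    and add :: "'v \<Rightarrow> 'v \<Rightarrow> 'v"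
    and zero :: 'v
    and scale :: "real \<Rightarrow> 'v \<Rightarrow> 'v"
  assumes add_closed: "\<lbrakk>u \<in> V; v \<in> V\<rbrakk> \<Longrightarrow> add u v \<in> V"
    and zero_closed: "zero \<in> V"
    and scale_closed: "v \<in> V \<Longrightarrow> scale c v \<in> V"
    and add_assoc: "\<lbrakk>u \<in> V; v \<in> V; w \<in> V\<rbrakk> \<Longrightarrow> add (add u v) w = add u (add v w)"
    and add_commute: "\<lbrakk>u \<in> V; v \<in> V\<rbrakk> \<Longrightarrow> add u v = add v u"
    and add_zero: "v \<in> V \<Longrightarrow> add zero v = v"
    and add_inverse: "v \<in> V \<Longrightarrow> \<exists>w\<in>V. add v w = zero"
    and scale_add_right: "\<lbrakk>u \<in> V; v \<in> V\<rbrakk> \<Longrightarrow> scale c (add u v) = add (scale c u) (scale c v)"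
    and scale_add_left: "v \<in> V \<Longrightarrow> scale (a + b) v = add (scale a v) (scale b v)"
    and scale_scale: "v \<in> V \<Longrightarrow> scale a (scale b v) = scale (a * b) v"
    and scale_one: "v \<in> V \<Longrightarrow> scale 1 v = v"

text \<open>
  The data of a bundle with base points in \<^typ>\<open>'a\<close> and total space in \<^typ>\<open>'e\<close>. The
  operations are total functions; \<open>fib_add\<close> is meaningful only for two points of the same fibre.
\<close>

record ('a, 'e) vbundle =
  total_space :: "'e topology"
  proj :: "'e \<Rightarrow> 'a"
  fib_add :: "'e \<Rightarrow> 'e \<Rightarrow> 'e"
  fib_zero :: "'a \<Rightarrow> 'e"
  fib_scale :: "real \<Rightarrow> 'e \<Rightarrow> 'e"

definition part_over :: "('a, 'e, 'z) vbundle_scheme \<Rightarrow> 'a set \<Rightarrow> 'e set" where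
  "part_over \<xi> U = {e \<in> topspace (total_space \<xi>). proj \<xi> e \<in> U}"

abbreviation fibre :: "('a, 'e, 'z) vbundle_scheme \<Rightarrow> 'a \<Rightarrow> 'e set" where
  "fibre \<xi> x \<equiv> part_over \<xi> {x}"

definition local_trivialization ::
  "'a topology \<Rightarrow> ('a, 'e, 'z) vbundle_scheme \<Rightarrow> 'a set \<Rightarrow> nat \<Rightarrow> ('a \<times> (nat \<Rightarrow> real) \<Rightarrow> 'e) \<Rightarrow> bool"
where
  "local_trivialization X \<xi> U d h \<longleftrightarrow>
     homeomorphic_map (prod_topology (subtopology X U) (Euclidean_space d))
       (subtopology (total_space \<xi>) (part_over \<xi> U)) h \<and>
     (\<forall>x\<in>U. \<forall>v\<in>topspace (Euclidean_space d).
        proj \<xi> (h (x, v)) = x \<and>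
        (\<forall>w\<in>topspace (Euclidean_space d).
           h (x, \<lambda>i. v i + w i) = fib_add \<xi> (h (x, v)) (h (x, w))) \<and>
        (\<forall>c. h (x, \<lambda>i. c * v i) = fib_scale \<xi> c (h (x, v))))"

text \<open>
  Every fibre is finite-dimensional because a local trivialization restricts to a linear
  isomorphism on it. The rank \<open>d\<close> may depend on the point, so it is only locally constant.
\<close>

locale real_vector_bundle =
  fixes X :: "'a topology" and \<xi> :: "('a, 'e, 'z) vbundle_scheme"
  assumes continuous_proj: "continuous_map (total_space \<xi>) X (proj \<xi>)"
    and fibre_vector_space:
      "x \<in> topspace X \<Longrightarrow>
        real_vector_space_on (fibre \<xi> x) (fib_add \<xi>) (fib_zero \<xi> x) (fib_scale \<xi>)"
    and locally_trivial:
      "x \<in> topspace X \<Longrightarrow> \<exists>U d h. openin X U \<and> x \<in> U \<and> local_trivialization X \<xi> U d h"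

definition bundle_section ::
  "'a topology \<Rightarrow> ('a, 'e, 'z) vbundle_scheme \<Rightarrow> ('a \<Rightarrow> 'e) \<Rightarrow> bool"
where
  "bundle_section X \<xi> s \<longleftrightarrow>
     continuous_map X (total_space \<xi>) s \<and> (\<forall>x\<in>topspace X. proj \<xi> (s x) = x)"

definition section_zeros ::
  "'a topology \<Rightarrow> ('a, 'e, 'z) vbundle_scheme \<Rightarrow> ('a \<Rightarrow> 'e) \<Rightarrow> 'a set"
where
  "section_zeros X \<xi> s = {x \<in> topspace X. s x = fib_zero \<xi> x}"

text \<open>
  The total space of the Whitney sum is the fibre product over \<open>X\<close>. A point of it is a base point
  \<open>x\<close> paired with a family of vectors of the fibres over \<open>x\<close>; keeping \<open>x\<close> in the pair makes the
  definition correct also for an empty index set.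
\<close>

definition whitney_sum ::
  "'a topology \<Rightarrow> 'k set \<Rightarrow> ('k \<Rightarrow> ('a, 'e, 'z) vbundle_scheme) \<Rightarrow> ('a, 'a \<times> ('k \<Rightarrow> 'e)) vbundle"
where
  "whitney_sum X K \<xi> =
     \<lparr>total_space =
        subtopology (prod_topology X (product_topology (\<lambda>k. total_space (\<xi> k)) K))
          {(x, f). \<forall>k\<in>K. proj (\<xi> k) (f k) = x},
      proj = fst,
      fib_add = (\<lambda>(x, f) (_, g). (x, \<lambda>k\<in>K. fib_add (\<xi> k) (f k) (g k))),
      fib_zero = (\<lambda>x. (x, \<lambda>k\<in>K. fib_zero (\<xi> k) x)),
      fib_scale = (\<lambda>c (x, f). (x, \<lambda>k\<in>K. fib_scale (\<xi> k) c (f k)))\<rparr>"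

lemma fibre_whitney_sum:
  assumes "x \<in> topspace X"
  shows "fibre (whitney_sum X K \<xi>) x = {x} \<times> (\<Pi>\<^sub>E k\<in>K. fibre (\<xi> k) x)"
  using assms by (auto simp: whitney_sum_def part_over_def PiE_def Pi_def extensional_def)

lemma real_vector_space_on_whitney_sum:
  assumes x: "x \<in> topspace X"
    and V: "\<And>k. k \<in> K \<Longrightarrow>
      real_vector_space_on (fibre (\<xi> k) x) (fib_add (\<xi> k)) (fib_zero (\<xi> k) x) (fib_scale (\<xi> k))"
  shows "real_vector_space_on (fibre (whitney_sum X K \<xi>) x) (fib_add (whitney_sum X K \<xi>))
           (fib_zero (whitney_sum X K \<xi>) x) (fib_scale (whitney_sum X K \<xi>))"
proof -
  note ax = real_vector_space_on.add_closed[OF V] real_vector_space_on.zero_closed[OF V]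
    real_vector_space_on.scale_closed[OF V] real_vector_space_on.add_zero[OF V]
    real_vector_space_on.scale_one[OF V]
  have ops: "fib_add (whitney_sum X K \<xi>) = (\<lambda>(x, f) (_, g). (x, \<lambda>k\<in>K. fib_add (\<xi> k) (f k) (g k)))"
    "fib_zero (whitney_sum X K \<xi>) x = (x, \<lambda>k\<in>K. fib_zero (\<xi> k) x)"
    "fib_scale (whitney_sum X K \<xi>) = (\<lambda>c (x, f). (x, \<lambda>k\<in>K. fib_scale (\<xi> k) c (f k)))"
    by (simp_all add: whitney_sum_def)
  have mem: "f k \<in> fibre (\<xi> k) x" if "f \<in> (\<Pi>\<^sub>E k\<in>K. fibre (\<xi> k) x)" "k \<in> K" for f k
    using that by auto
  show ?thesis
    unfolding fibre_whitney_sum[OF x] ops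
  proof (unfold_locales, goal_cases)
    case (1 u v) then show ?case by (auto simp: ax mem)
  next
    case 2 then show ?case by (auto simp: ax)
  next
    case (3 v c) then show ?case by (auto simp: ax mem)
  next
    case (4 u v w) then show ?case
      by (auto simp: mem intro!: restrict_ext real_vector_space_on.add_assoc[OF V])
  next
    case (5 u v) then show ?case
      by (auto simp: mem intro!: restrict_ext real_vector_space_on.add_commute[OF V])
  next
    case (6 v) then show ?case by (auto simp: ax mem fun_eq_iff PiE_def extensional_def)
  next
    case (7 v)
    then obtain f where f: "v = (x, f)" "f \<in> (\<Pi>\<^sub>E k\<in>K. fibre (\<xi> k) x)" by auto
    have "\<forall>k\<in>K. \<exists>w\<in>fibre (\<xi> k) x. fib_add (\<xi> k) (f k) w = fib_zero (\<xi> k) x"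
      using real_vector_space_on.add_inverse[OF V] mem[OF f(2)] by blast
    then obtain g where "\<forall>k\<in>K. g k \<in> fibre (\<xi> k) x \<and> fib_add (\<xi> k) (f k) (g k) = fib_zero (\<xi> k) x"
      by metis
    then show ?case using f
      by (intro bexI[where x = "(x, \<lambda>k\<in>K. g k)"]) (auto intro!: restrict_ext)
  next
    case (8 u v c) then show ?case
      by (auto simp: mem intro!: restrict_ext real_vector_space_on.scale_add_right[OF V])
  next
    case (9 v a b) then show ?case
      by (auto simp: mem intro!: restrict_ext real_vector_space_on.scale_add_left[OF V])
  next
    case (10 v a b) then show ?case
      by (auto simp: mem intro!: restrict_ext real_vector_space_on.scale_scale[OF V])
  next
    case (11 v) then show ?case by (auto simp: ax mem fun_eq_iff PiE_def extensional_def)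
  qed
qed

lemma continuous_map_Euclidean_space_coordinate:
  "continuous_map (Euclidean_space d) euclideanreal (\<lambda>v. v i)"
  unfolding Euclidean_space_def
  by (intro continuous_map_from_subtopology continuous_map_product_projection) simp

lemma real_vector_bundle_whitney_sum:
  fixes X :: "'a topology" and \<xi> :: "'k \<Rightarrow> ('a, 'e, 'z) vbundle_scheme"
  assumes K: "finite K" and B: "\<And>k. k \<in> K \<Longrightarrow> real_vector_bundle X (\<xi> k)"
  shows "real_vector_bundle X (whitney_sum X K \<xi>)"
proof (rule real_vector_bundle.intro)
  show "continuous_map (total_space (whitney_sum X K \<xi>)) X (proj (whitney_sum X K \<xi>))"
    by (simp add: whitney_sum_def continuous_map_from_subtopology continuous_map_fst)
next
  fix x assume "x \<in> topspace X"
  then show "real_vector_space_on (fibre (whitney_sum X K \<xi>) x) (fib_add (whitney_sum X K \<xi>))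
           (fib_zero (whitney_sum X K \<xi>) x) (fib_scale (whitney_sum X K \<xi>))"
    by (intro real_vector_space_on_whitney_sum real_vector_bundle.fibre_vector_space[OF B])
next
  fix x assume x: "x \<in> topspace X"
  have "\<forall>k\<in>K. \<exists>U d h. openin X U \<and> x \<in> U \<and> local_trivialization X (\<xi> k) U d h"
    using real_vector_bundle.locally_trivial[OF B x] by blast
  then obtain U d h where *: "\<forall>k\<in>K. openin X (U k) \<and> x \<in> U k \<and>
      local_trivialization X (\<xi> k) (U k) (d k) (h k)"
    by metis
  have U: "openin X (U k)" "x \<in> U k" and triv: "local_trivialization X (\<xi> k) (U k) (d k) (h k)"
    if "k \<in> K" for k using * that by auto
  have "\<forall>k\<in>K. \<exists>g. homeomorphic_maps (prod_topology (subtopology X (U k)) (Euclidean_space (d k)))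
       (subtopology (total_space (\<xi> k)) (part_over (\<xi> k) (U k))) (h k) g"
    using triv by (auto simp: local_trivialization_def homeomorphic_map_maps)
  then obtain g where g: "\<And>k. k \<in> K \<Longrightarrow>
      homeomorphic_maps (prod_topology (subtopology X (U k)) (Euclidean_space (d k)))
       (subtopology (total_space (\<xi> k)) (part_over (\<xi> k) (U k))) (h k) (g k)"
    by metis
  define W where "W = topspace X \<inter> (\<Inter>k\<in>K. U k)"
  have W: "openin X W" "x \<in> W" "W \<subseteq> topspace X" "\<And>k. k \<in> K \<Longrightarrow> W \<subseteq> U k"
  proof -
    show "openin X W"
      unfolding W_def using K U by (intro openin_Int_Inter) auto
  qed (use x U in \<open>auto simp: W_def\<close>)
  define D where "D = (\<Sum>k\<in>K. d k)"
  have "card {..<D} = card (SIGMA k:K. {..<d k})"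
    using K by (simp add: D_def)
  then obtain b where b: "bij_betw b {..<D} (SIGMA k:K. {..<d k})"
    using K by (metis finite_SigmaI finite_lessThan finite_same_card_bij)
  define c where "c = the_inv_into {..<D} b"
  have bc: "b (c (k, i)) = (k, i)" "c (k, i) < D" if "k \<in> K" "i < d k" for k i
    using b that f_the_inv_into_f_bij_betw[OF b, of "(k, i)"] bij_betwE[OF bij_betw_the_inv_into[OF b]]
    by (auto simp: c_def)
  have cb: "c (b j) = j" "fst (b j) \<in> K" "snd (b j) < d (fst (b j))" if "j < D" for j
  proof -
    show "c (b j) = j" using b that by (simp add: c_def the_inv_into_f_f bij_betw_def)
    have "b j \<in> (SIGMA k:K. {..<d k})" using bij_betwE[OF b] that by blast
    then show "fst (b j) \<in> K" "snd (b j) < d (fst (b j))" by auto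
  qed
  define blk where "blk k v = (\<lambda>i. if i < d k then v (c (k, i)) else (0::real))" for k v
  define H where "H = (\<lambda>(y, v). (y, \<lambda>k\<in>K. h k (y, blk k v)))"
  define G :: "'a \<times> ('k \<Rightarrow> 'e) \<Rightarrow> 'a \<times> (nat \<Rightarrow> real)" where "G = (\<lambda>(y, f). (y, \<lambda>j. if j < D then snd (g (fst (b j)) (f (fst (b j)))) (snd (b j)) else 0))"
  have blk: "blk k v \<in> topspace (Euclidean_space (d k))" for k v
    by (simp add: blk_def topspace_Euclidean_space)
  let ?S = "whitney_sum X K \<xi>"
  let ?A = "prod_topology (subtopology X W) (Euclidean_space D)"
  let ?B = "subtopology (total_space ?S) (part_over ?S W)"
  have h: "continuous_map (prod_topology (subtopology X (U k)) (Euclidean_space (d k))) (total_space (\<xi> k)) (h k)"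
    "continuous_map (subtopology (total_space (\<xi> k)) (part_over (\<xi> k) (U k)))
        (prod_topology (subtopology X (U k)) (Euclidean_space (d k))) (g k)"
    if "k \<in> K" for k
    using g[OF that] by (auto simp: homeomorphic_maps_def continuous_map_in_subtopology)
  have ph: "proj (\<xi> k) (h k (y, v)) = y" if "k \<in> K" "y \<in> W" "v \<in> topspace (Euclidean_space (d k))" for k y v
    using triv[OF that(1)] W(4)[OF that(1)] that by (auto simp: local_trivialization_def)
  have gh: "g k (h k (y, v)) = (y, v)" if "k \<in> K" "y \<in> W" "v \<in> topspace (Euclidean_space (d k))" for k y v
    using g[OF that(1)] W(4)[OF that(1)] W(3) that by (auto simp: homeomorphic_maps_def)
  have hg: "h k (g k e) = e" "fst (g k e) = proj (\<xi> k) e" "snd (g k e) \<in> topspace (Euclidean_space (d k))"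
    if "k \<in> K" "e \<in> topspace (total_space (\<xi> k))" "proj (\<xi> k) e \<in> W" for k e
  proof -
    have e: "e \<in> topspace (subtopology (total_space (\<xi> k)) (part_over (\<xi> k) (U k)))"
      using that W by (auto simp: part_over_def)
    show 1: "h k (g k e) = e" using g[OF that(1)] e by (auto simp: homeomorphic_maps_def)
    have 2: "g k e \<in> topspace (prod_topology (subtopology X (U k)) (Euclidean_space (d k)))"
      using h(2)[OF that(1)] e continuous_map_image_subset_topspace by blast
    then show "snd (g k e) \<in> topspace (Euclidean_space (d k))" by auto
    have "proj (\<xi> k) (h k (fst (g k e), snd (g k e))) = fst (g k e)"
      using triv[OF that(1)] 2 by (auto simp: local_trivialization_def)
    then show "fst (g k e) = proj (\<xi> k) e" using 1 by simp
  qed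
  have B_top: "(y, f) \<in> topspace ?B \<longleftrightarrow> y \<in> W \<and> f \<in> (\<Pi>\<^sub>E k\<in>K. fibre (\<xi> k) y)" for y f
    using W(3) by (auto simp: whitney_sum_def part_over_def PiE_def Pi_def)
  have contH: "continuous_map ?A ?B H"
  proof -
    have cmp: "continuous_map ?A (total_space (\<xi> k)) (\<lambda>z. h k (fst z, blk k (snd z)))" if k: "k \<in> K" for k
    proof -
      have "continuous_map ?A (Euclidean_space (d k)) (\<lambda>z. blk k (snd z))"
        unfolding blk_def continuous_map_componentwise_Euclidean_space
        using continuous_map_compose[OF continuous_map_snd continuous_map_Euclidean_space_coordinate]
        by (auto simp: o_def)
      moreover have "continuous_map ?A (subtopology X (U k)) fst"
        using W(4)[OF k]
        by (auto simp: continuous_map_in_subtopology intro!: continuous_map_into_fulltopology[OF continuous_map_fst])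
      ultimately have "continuous_map ?A (prod_topology (subtopology X (U k)) (Euclidean_space (d k)))
          (\<lambda>z. (fst z, blk k (snd z)))"
        by (simp add: continuous_map_paired)
      from continuous_map_compose[OF this h(1)[OF k]] show ?thesis by (simp add: o_def)
    qed
    have "continuous_map ?A (prod_topology X (product_topology (\<lambda>k. total_space (\<xi> k)) K)) H"
      unfolding H_def case_prod_unfold continuous_map_paired continuous_map_componentwise
      using cmp
      by (auto simp: o_def intro!: continuous_map_into_fulltopology[OF continuous_map_fst] cong: restrict_cong)
    moreover have "H z \<in> topspace ?B" if z: "z \<in> topspace ?A" for z
    proof -
      obtain y v where yv: "z = (y, v)" "y \<in> W" using z by auto
      have "h k (y, blk k v) \<in> fibre (\<xi> k) y" if k: "k \<in> K" for k
      proof -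
        have "h k (y, blk k v) \<in> topspace (total_space (\<xi> k))"
          using continuous_map_image_subset_topspace[OF cmp[OF k]] z yv by force
        then show ?thesis using ph[OF k yv(2) blk] by (simp add: part_over_def)
      qed
      then show ?thesis using yv B_top by (simp add: H_def)
    qed
    ultimately show ?thesis
      by (auto simp: continuous_map_in_subtopology whitney_sum_def)
  qed
  have contG: "continuous_map ?B ?A G"
  proof -
    have fstB: "continuous_map ?B X fst"
      by (simp add: whitney_sum_def continuous_map_from_subtopology continuous_map_fst)
    have "continuous_map ?B (subtopology X W) fst"
      using fstB by (auto simp: continuous_map_in_subtopology part_over_def whitney_sum_def)
    moreover have "continuous_map ?B (Euclidean_space D)
       (\<lambda>z j. if j < D then snd (g (fst (b j)) (snd z (fst (b j)))) (snd (b j)) else 0)"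
      unfolding continuous_map_componentwise_Euclidean_space
    proof (intro allI impI)
      fix j assume "j < D"
      define k where "k = fst (b j)"
      have k: "k \<in> K" using cb \<open>j < D\<close> by (simp add: k_def)
      have "continuous_map ?B (product_topology (\<lambda>k. total_space (\<xi> k)) K) snd"
        by (simp add: whitney_sum_def continuous_map_from_subtopology continuous_map_snd)
      from continuous_map_compose[OF this continuous_map_product_projection[OF k]]
      have "continuous_map ?B (total_space (\<xi> k)) (\<lambda>z. snd z k)" by (simp add: o_def)
      moreover have "snd z k \<in> part_over (\<xi> k) (U k)" if "z \<in> topspace ?B" for z
        using that B_top[of "fst z" "snd z"] k W(4)[OF k] by (auto simp: part_over_def PiE_iff)
      ultimately have "continuous_map ?B (subtopology (total_space (\<xi> k)) (part_over (\<xi> k) (U k))) (\<lambda>z. snd z k)"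
        by (auto simp: continuous_map_in_subtopology)
      from continuous_map_compose[OF continuous_map_compose[OF continuous_map_compose[OF this h(2)[OF k]]
          continuous_map_snd] continuous_map_Euclidean_space_coordinate[of _ "snd (b j)"]]
      show "continuous_map ?B euclideanreal (\<lambda>z. snd (g (fst (b j)) (snd z (fst (b j)))) (snd (b j)))"
        by (simp add: o_def k_def)
    qed
    ultimately show ?thesis
      by (simp add: G_def case_prod_unfold continuous_map_paired)
  qed
  have "homeomorphic_maps ?A ?B H G"
    unfolding homeomorphic_maps_def
  proof (intro conjI ballI contH contG)
    fix z assume "z \<in> topspace ?A"
    then obtain y v where z: "z = (y, v)" "y \<in> W" "v \<in> topspace (Euclidean_space D)"
      by auto
    have "snd (g (fst (b j)) (h (fst (b j)) (y, blk (fst (b j)) v))) (snd (b j)) = v j" if "j < D" for j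
      using gh[OF cb(2)[OF that] z(2) blk] cb[OF that] by (simp add: blk_def)
    then show "G (H z) = z"
      using z cb by (auto simp: G_def H_def topspace_Euclidean_space fun_eq_iff)
  next
    fix w assume w: "w \<in> topspace ?B"
    obtain y f where yf: "w = (y, f)" by (cases w)
    have y: "y \<in> W" and f: "f \<in> (\<Pi>\<^sub>E k\<in>K. fibre (\<xi> k) y)" using w B_top yf by auto
    have "h k (y, blk k (snd (G w))) = f k" if k: "k \<in> K" for k
    proof -
      have fk: "f k \<in> topspace (total_space (\<xi> k))" "proj (\<xi> k) (f k) = y"
        using f k by (auto simp: part_over_def PiE_iff)
      have "blk k (snd (G w)) = snd (g k (f k))"
        using hg(3)[OF k fk(1)] fk y bc[OF k]
        by (auto simp: blk_def G_def yf fun_eq_iff topspace_Euclidean_space)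
      then show ?thesis using hg(1,2)[OF k fk(1)] fk y by (metis prod.collapse)
    qed
    then show "H (G w) = w"
      using f by (auto simp: H_def yf G_def fun_eq_iff PiE_iff extensional_def)
  qed
  then have "local_trivialization X ?S W D H"
    unfolding local_trivialization_def
  proof (intro conjI ballI allI)
    fix y v w assume y: "y \<in> W"
    have blk_add: "blk k (\<lambda>i. v i + w i) = (\<lambda>i. blk k v i + blk k w i)" for k
      by (auto simp: blk_def)
    show "H (y, \<lambda>i. v i + w i) = fib_add ?S (H (y, v)) (H (y, w))"
      unfolding H_def whitney_sum_def using y W(4) triv blk
      by (auto simp: blk_add local_trivialization_def subset_iff intro!: restrict_ext)
  next
    fix y v a assume y: "y \<in> W"
    have blk_scale: "blk k (\<lambda>i. a * v i) = (\<lambda>i. a * blk k v i)" for k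
      by (auto simp: blk_def)
    show "H (y, \<lambda>i. a * v i) = fib_scale ?S a (H (y, v))"
      unfolding H_def whitney_sum_def using y W(4) triv blk
      by (auto simp: blk_scale local_trivialization_def subset_iff intro!: restrict_ext)
  qed (auto simp: homeomorphic_map_maps H_def whitney_sum_def)
  then show "\<exists>U d h. openin X U \<and> x \<in> U \<and> local_trivialization X ?S U d h"
    using W by blast
qed

end

theory Submission
  imports Defs
begin

text \<open>
  The \<open>U i\<close> overlap, so the given sections of one summand \<open>\<xi> k\<close> cannot simply be added up: where
  several of them are present they may cancel. The remedy is to replace the cover by \<open>n\<close> families of
  pairwise disjoint open sets, one family for each summand.

  Choose continuous \<open>\<phi> i \<ge> 0\<close> that are positive only inside \<open>U i\<close> and have no common zero
  (\<open>exists_subordinate_bump_functions\<close>). For a nonempty \<open>J \<subseteq> I\<close> let \<open>W J\<close> be the open set where every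
  \<open>\<phi> j\<close> with \<open>j \<in> J\<close> is positive and exceeds every \<open>\<phi> i\<close> with \<open>i \<notin> J\<close>; it is the set where the
  continuous weight \<open>dominance \<phi> I J\<close> is nonzero. At a point of \<open>W J\<close> the indices in \<open>J\<close> are those
  of the \<open>card J\<close> largest values, so \<open>J\<close> is determined by its cardinality, and sets \<open>W J\<close> with
  \<open>J\<close> of a fixed size \<open>k\<close> are disjoint (\<open>dominance_disjoint\<close>). Each such \<open>W J\<close> lies in \<open>U i\<close> for any \<open>i \<in> J\<close>, so
  a section of \<open>\<xi> k\<close> without zeros on \<open>W J\<close> is available; weighting it by \<open>dominance \<phi> I J\<close> and
  summing over the sets \<open>J\<close> of size \<open>k\<close> gives a section \<open>s k\<close> of \<open>\<xi> k\<close>. At most one term is nonzero at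
  each point, so nothing cancels (\<open>disjointly_weighted_section\<close>).

  Finally, every point \<open>x\<close> lies in \<open>W J\<close> for \<open>J = {i. \<phi> i x > 0}\<close>. This \<open>J\<close> is nonempty, and it has at
  most \<open>n\<close> elements because \<open>x \<in> U i\<close> for \<open>i \<in> J\<close>. Hence \<open>s (card J)\<close> does not vanish at \<open>x\<close>, and
  \<open>(s 1, \<dots>, s n)\<close> is a nowhere zero section of the Whitney sum.
\<close>

section \<open>Scalar multiplication in a vector space on a carrier set\<close>

lemma (in real_vector_space_on) scale_zero_left:
  assumes v: "v \<in> V" shows "scale 0 v = zero"
proof -
  let ?z = "scale 0 v"
  have z: "?z \<in> V" using v by (rule scale_closed)
  obtain w where w: "w \<in> V" "add ?z w = zero" using add_inverse[OF z] by blast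
  have "add ?z ?z = ?z" using scale_add_left[OF v, of 0 0] by simp
  then have "add ?z (add ?z w) = add ?z w" using add_assoc[OF z z w(1)] by simp
  then show ?thesis using w add_commute[OF z zero_closed] add_zero[OF z] by simp
qed

lemma (in real_vector_space_on) scale_zero_right: "scale c zero = zero"
  using scale_zero_left[OF zero_closed] scale_scale[OF zero_closed, of c 0] by simp

lemma (in real_vector_space_on) scale_eq_zero_iff:
  assumes v: "v \<in> V" and c: "c \<noteq> 0"
  shows "scale c v = zero \<longleftrightarrow> v = zero"
proof
  assume "scale c v = zero"
  then have "scale (inverse c) (scale c v) = zero" by (simp add: scale_zero_right)
  then show "v = zero" using scale_scale[OF v] scale_one[OF v] c by simp
qed (simp add: scale_zero_right)

section \<open>Operations on sections\<close>

lemma bundle_section_in_fibre: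
  assumes "bundle_section X \<xi> s" "x \<in> topspace X"
  shows "s x \<in> fibre \<xi> x"
  using assms continuous_map_image_subset_topspace[of X "total_space \<xi>" s]
  by (auto simp: bundle_section_def part_over_def)

lemma section_coordinates:
  assumes triv: "local_trivialization X \<xi> U d h" and U: "openin X U"
    and s: "bundle_section X \<xi> s"
  obtains v where "continuous_map (subtopology X U) (Euclidean_space d) v"
    and "\<And>x. x \<in> U \<Longrightarrow> s x = h (x, v x)"
proof -
  let ?E = "subtopology (total_space \<xi>) (part_over \<xi> U)"
  let ?P = "prod_topology (subtopology X U) (Euclidean_space d)"
  have sub: "U \<subseteq> topspace X" using U by (rule openin_subset)
  obtain g where g: "homeomorphic_maps ?P ?E h g"
    using triv by (auto simp: local_trivialization_def homeomorphic_map_maps)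
  have s_in: "s x \<in> topspace ?E" if "x \<in> U" for x
    using bundle_section_in_fibre[OF s] sub that by (auto simp: part_over_def)
  have "continuous_map (subtopology X U) ?E s"
    using s s_in by (auto simp: bundle_section_def continuous_map_in_subtopology
        intro: continuous_map_from_subtopology)
  then have gs: "continuous_map (subtopology X U) ?P (g \<circ> s)"
    using g by (auto simp: homeomorphic_maps_def intro: continuous_map_compose)
  show thesis
  proof
    show "continuous_map (subtopology X U) (Euclidean_space d) (snd \<circ> (g \<circ> s))"
      using gs by (rule continuous_map_compose[OF _ continuous_map_snd])
    fix x assume x: "x \<in> U"
    have gsP: "g (s x) \<in> topspace ?P"
      using continuous_map_image_subset_topspace[OF gs] sub x by force
    have hg: "h (g (s x)) = s x" using g s_in[OF x] by (auto simp: homeomorphic_maps_def)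
    have "proj \<xi> (h (fst (g (s x)), snd (g (s x)))) = fst (g (s x))"
      using triv gsP by (auto simp: local_trivialization_def)
    moreover have "proj \<xi> (s x) = x" using s sub x by (auto simp: bundle_section_def)
    ultimately show "s x = h (x, (snd \<circ> (g \<circ> s)) x)"
      using hg by (metis comp_apply prod.collapse)
  qed
qed

lemma continuous_map_of_coordinates:
  assumes triv: "local_trivialization X \<xi> U d h"
    and v: "continuous_map (subtopology X U) (Euclidean_space d) v"
  shows "continuous_map (subtopology X U) (total_space \<xi>) (\<lambda>x. h (x, v x))"
proof -
  have h: "continuous_map (prod_topology (subtopology X U) (Euclidean_space d)) (total_space \<xi>) h"
    using triv
    by (auto simp: local_trivialization_def
        intro: continuous_map_into_fulltopology dest: homeomorphic_imp_continuous_map)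
  have "continuous_map (subtopology X U) (prod_topology (subtopology X U) (Euclidean_space d))
          (\<lambda>x. (x, v x))"
    using v by (simp add: continuous_map_paired)
  from continuous_map_compose[OF this h] show ?thesis by (simp add: o_def)
qed

lemma continuous_map_Euclidean_space_iff:
  "continuous_map X (Euclidean_space d) v \<longleftrightarrow>
     (\<forall>i. continuous_map X euclideanreal (\<lambda>x. v x i)) \<and> (\<forall>x\<in>topspace X. \<forall>i\<ge>d. v x i = 0)"
  by (auto simp: Euclidean_space_def continuous_map_in_subtopology continuous_map_componentwise_UNIV
      Pi_iff image_subset_iff)

text \<open>
  Continuity into the total space can be checked in local trivializations, where sections are
  vector-valued functions and the fibre operations become coordinatewise.
\<close>

lemma (in real_vector_bundle) bundle_section_scale_add:
  assumes s: "bundle_section X \<xi> s" and t: "bundle_section X \<xi> t"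
    and c: "continuous_map X euclideanreal c"
  shows "bundle_section X \<xi> (\<lambda>x. fib_add \<xi> (fib_scale \<xi> (c x) (s x)) (t x))"
    (is "bundle_section X \<xi> ?r")
proof -
  have r: "?r x \<in> fibre \<xi> x" if x: "x \<in> topspace X" for x
    using fibre_vector_space[OF x] bundle_section_in_fibre[OF s x] bundle_section_in_fibre[OF t x]
    by (simp add: real_vector_space_on.add_closed real_vector_space_on.scale_closed)
  have loc: "\<exists>U. openin X U \<and> x \<in> U \<and> continuous_map (subtopology X U) (total_space \<xi>) ?r"
    if x: "x \<in> topspace X" for x
  proof -
    obtain U d h where U: "openin X U" "x \<in> U" and triv: "local_trivialization X \<xi> U d h"
      using locally_trivial[OF x] by blast
    obtain v where v: "continuous_map (subtopology X U) (Euclidean_space d) v"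
      and sv: "\<And>x. x \<in> U \<Longrightarrow> s x = h (x, v x)"
      using section_coordinates[OF triv U(1) s] by blast
    obtain w where w: "continuous_map (subtopology X U) (Euclidean_space d) w"
      and tw: "\<And>x. x \<in> U \<Longrightarrow> t x = h (x, w x)"
      using section_coordinates[OF triv U(1) t] by blast
    have sub: "U \<subseteq> topspace X" using U(1) by (rule openin_subset)
    have "continuous_map (subtopology X U) (Euclidean_space d) (\<lambda>x i. c x * v x i + w x i)"
      using v w c unfolding continuous_map_Euclidean_space_iff
      by (auto intro!: continuous_intros intro: continuous_map_from_subtopology)
    then have "continuous_map (subtopology X U) (total_space \<xi>)
                 (\<lambda>x. h (x, \<lambda>i. c x * v x i + w x i))"
      by (rule continuous_map_of_coordinates[OF triv])
    moreover have "h (y, \<lambda>i. c y * v y i + w y i) = ?r y" if y: "y \<in> U" for y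
    proof -
      have vw: "v y \<in> topspace (Euclidean_space d)" "w y \<in> topspace (Euclidean_space d)"
        using v w y sub by (auto simp: continuous_map_def)
      then have "(\<lambda>i. c y * v y i) \<in> topspace (Euclidean_space d)"
        by (simp add: topspace_Euclidean_space)
      then show ?thesis
        using triv vw y sv[OF y] tw[OF y] by (simp add: local_trivialization_def)
    qed
    ultimately have "continuous_map (subtopology X U) (total_space \<xi>) ?r"
      by (rule continuous_map_eq) simp
    then show ?thesis using U by blast
  qed
  have "continuous_map X (total_space \<xi>) ?r"
    by (rule pasting_lemma[where T = id and f = "\<lambda>_. ?r" and
          I = "{U. openin X U \<and> continuous_map (subtopology X U) (total_space \<xi>) ?r}"])
       (use loc in auto)
  then show ?thesis using r by (auto simp: bundle_section_def part_over_def)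
qed

lemma (in real_vector_bundle) trivialization_zero:
  assumes triv: "local_trivialization X \<xi> U d h" and U: "openin X U" and x: "x \<in> U"
  shows "h (x, \<lambda>_. 0) = fib_zero \<xi> x"
proof -
  have xX: "x \<in> topspace X" using U x openin_subset by blast
  interpret F: real_vector_space_on "fibre \<xi> x" "fib_add \<xi>" "fib_zero \<xi> x" "fib_scale \<xi>"
    using fibre_vector_space[OF xX] .
  have z: "(\<lambda>_. 0) \<in> topspace (Euclidean_space d)" by (simp add: topspace_Euclidean_space)
  have "h (x, \<lambda>_. 0) \<in> topspace (total_space \<xi>)"
    using continuous_map_image_subset_topspace[OF continuous_map_of_coordinates[OF triv,
          of "\<lambda>_ _. 0"]] x xX z by auto
  then have hx: "h (x, \<lambda>_. 0) \<in> fibre \<xi> x"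
    using triv x z by (auto simp: local_trivialization_def part_over_def)
  have "h (x, \<lambda>i. c * v i) = fib_scale \<xi> c (h (x, v))" if "v \<in> topspace (Euclidean_space d)" for c v
    using triv x that unfolding local_trivialization_def by blast
  from this[OF z, of 0] show ?thesis using F.scale_zero_left[OF hx] by simp
qed

lemma (in real_vector_bundle) bundle_section_zero: "bundle_section X \<xi> (fib_zero \<xi>)"
proof -
  have loc: "\<exists>U. openin X U \<and> x \<in> U \<and> continuous_map (subtopology X U) (total_space \<xi>) (fib_zero \<xi>)"
    if x: "x \<in> topspace X" for x
  proof -
    obtain U d h where U: "openin X U" "x \<in> U" and triv: "local_trivialization X \<xi> U d h"
      using locally_trivial[OF x] by blast
    have "continuous_map (subtopology X U) (total_space \<xi>) (\<lambda>x. h (x, \<lambda>_. 0))"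
      by (rule continuous_map_of_coordinates[OF triv]) (simp add: topspace_Euclidean_space)
    then have "continuous_map (subtopology X U) (total_space \<xi>) (fib_zero \<xi>)"
      by (rule continuous_map_eq) (simp add: trivialization_zero[OF triv U(1)])
    then show ?thesis using U by blast
  qed
  have "continuous_map X (total_space \<xi>) (fib_zero \<xi>)"
    by (rule pasting_lemma[where T = id and f = "\<lambda>_. fib_zero \<xi>" and
          I = "{U. openin X U \<and> continuous_map (subtopology X U) (total_space \<xi>) (fib_zero \<xi>)}"])
       (use loc in auto)
  then show ?thesis
    using real_vector_space_on.zero_closed[OF fibre_vector_space]
    by (auto simp: bundle_section_def part_over_def)
qed

text \<open>
  The sum \<open>\<Sum>a\<in>A. w a \<cdot> t a\<close>, built one term at a time. Since at most one weight is nonzero at each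
  point, its values are described without a sum: they are the active term, or zero.
\<close>

lemma (in real_vector_bundle) disjointly_weighted_section:
  assumes "finite A"
    and "\<And>a. a \<in> A \<Longrightarrow> bundle_section X \<xi> (t a)"
    and "\<And>a. a \<in> A \<Longrightarrow> continuous_map X euclideanreal (w a)"
    and "\<And>a b x. \<lbrakk>a \<in> A; b \<in> A; x \<in> topspace X; w a x \<noteq> 0; w b x \<noteq> 0\<rbrakk> \<Longrightarrow> a = b"
  shows "\<exists>s. bundle_section X \<xi> s \<and>
           (\<forall>x\<in>topspace X. (\<forall>a\<in>A. w a x \<noteq> 0 \<longrightarrow> s x = fib_scale \<xi> (w a x) (t a x)) \<and>
                           ((\<forall>a\<in>A. w a x = 0) \<longrightarrow> s x = fib_zero \<xi> x))"
  using assms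
proof (induction A rule: finite_induct)
  case empty
  show ?case using bundle_section_zero by auto
next
  case (insert a A)
  have IH: "\<exists>s. bundle_section X \<xi> s \<and>
           (\<forall>x\<in>topspace X. (\<forall>b\<in>A. w b x \<noteq> 0 \<longrightarrow> s x = fib_scale \<xi> (w b x) (t b x)) \<and>
                           ((\<forall>b\<in>A. w b x = 0) \<longrightarrow> s x = fib_zero \<xi> x))"
  proof (rule insert.IH)
    show "b = c" if "b \<in> A" "c \<in> A" "x \<in> topspace X" "w b x \<noteq> 0" "w c x \<noteq> 0" for b c x
      using insert.prems(3)[of b c x] that by simp
  qed (use insert.prems(1,2) in auto)
  obtain s where s: "bundle_section X \<xi> s"
    and active: "\<And>x b. \<lbrakk>x \<in> topspace X; b \<in> A; w b x \<noteq> 0\<rbrakk> \<Longrightarrow> s x = fib_scale \<xi> (w b x) (t b x)"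
    and inactive: "\<And>x. \<lbrakk>x \<in> topspace X; \<forall>b\<in>A. w b x = 0\<rbrakk> \<Longrightarrow> s x = fib_zero \<xi> x"
    using IH by blast
  let ?r = "\<lambda>x. fib_add \<xi> (fib_scale \<xi> (w a x) (t a x)) (s x)"
  have r: "bundle_section X \<xi> ?r"
    using insert.prems s by (intro bundle_section_scale_add) auto
  have "(\<forall>b\<in>insert a A. w b x \<noteq> 0 \<longrightarrow> ?r x = fib_scale \<xi> (w b x) (t b x)) \<and>
        ((\<forall>b\<in>insert a A. w b x = 0) \<longrightarrow> ?r x = fib_zero \<xi> x)" if x: "x \<in> topspace X" for x
  proof -
    interpret F: real_vector_space_on "fibre \<xi> x" "fib_add \<xi>" "fib_zero \<xi> x" "fib_scale \<xi>"
      using fibre_vector_space[OF x] .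
    have mem: "t a x \<in> fibre \<xi> x" "s x \<in> fibre \<xi> x"
      using insert.prems(1) s x by (auto intro!: bundle_section_in_fibre)
    show ?thesis
    proof (cases "w a x = 0")
      case True
      then have r_eq: "?r x = s x" using mem by (simp add: F.scale_zero_left F.add_zero)
      show ?thesis unfolding r_eq using True active[OF x] inactive[OF x] by auto
    next
      case False
      have none: "w b x = 0" if "b \<in> A" for b
        using insert.prems(3)[of a b x] insert.hyps(2) that x False by auto
      then have "s x = fib_zero \<xi> x" using inactive[OF x] by simp
      then have "?r x = fib_scale \<xi> (w a x) (t a x)"
        using mem F.add_commute F.add_zero F.scale_closed F.zero_closed by metis
      then show ?thesis using False none by auto
    qed
  qed
  then show ?case using r by blast
qed

lemma bundle_section_whitney_sum:
  assumes "\<And>k. k \<in> K \<Longrightarrow> bundle_section X (\<xi> k) (s k)"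
  shows "bundle_section X (whitney_sum X K \<xi>) (\<lambda>x. (x, \<lambda>k\<in>K. s k x))"
  using assms
  by (auto simp: bundle_section_def whitney_sum_def continuous_map_in_subtopology
      continuous_map_paired continuous_map_componentwise)

section \<open>Disjoint families from a cover\<close>

text \<open>
  Complete regularity gives a bump around each point inside a member of the cover. Finitely many of
  them suffice by compactness, and \<open>\<phi> i\<close> is the sum of those that were chosen inside \<open>U i\<close>.
\<close>

lemma exists_subordinate_bump_functions:
  assumes "compact_space X" and "Hausdorff_space X"
    and U: "\<And>i. i \<in> I \<Longrightarrow> openin X (U i)" and cover: "(\<Union>i\<in>I. U i) = topspace X"
  obtains \<phi> :: "'i \<Rightarrow> 'a \<Rightarrow> real"
  where "\<And>i. continuous_map X euclideanreal (\<phi> i)"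
    and "\<And>i x. \<phi> i x \<ge> 0"
    and "\<And>i x. \<lbrakk>x \<in> topspace X; \<phi> i x > 0\<rbrakk> \<Longrightarrow> x \<in> U i"
    and "\<And>x. x \<in> topspace X \<Longrightarrow> \<exists>i\<in>I. \<phi> i x > 0"
proof -
  have "completely_regular_space X"
    using assms(1,2) compact_Hausdorff_or_regular_imp_normal_space normal_imp_completely_regular_space
    by blast
  have "\<exists>i g. i \<in> I \<and> continuous_map X euclideanreal g \<and> (\<forall>x\<in>topspace X. g x \<ge> 0) \<and> g p > 0 \<and>
          (\<forall>x\<in>topspace X. g x > 0 \<longrightarrow> x \<in> U i)"
    if p: "p \<in> topspace X" for p
  proof -
    obtain i where i: "i \<in> I" "p \<in> U i" using p cover by blast
    obtain f where f: "continuous_map X (top_of_set {0..1::real}) f" "f p = 0"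
      "f ` (topspace X - U i) \<subseteq> {1}"
      using \<open>completely_regular_space X\<close> p i U[OF i(1)] unfolding completely_regular_space_def
      by (metis DiffD2 DiffI closedin_diff closedin_topspace)
    have le: "f x \<le> 1" if "x \<in> topspace X" for x
      using f(1) that by (auto simp: continuous_map_in_subtopology)
    have "continuous_map X euclideanreal (\<lambda>x. 1 - f x)"
      using continuous_map_into_fulltopology[OF f(1)] by (intro continuous_intros) auto
    then show ?thesis using i f le by (intro exI[of _ i] exI[of _ "\<lambda>x. 1 - f x"]) force
  qed
  then have "\<forall>p\<in>topspace X. \<exists>i g. i \<in> I \<and> continuous_map X euclideanreal g \<and>
      (\<forall>x\<in>topspace X. g x \<ge> 0) \<and> g p > 0 \<and> (\<forall>x\<in>topspace X. g x > 0 \<longrightarrow> x \<in> U i)"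
    by blast
  from bchoice[OF this] obtain \<iota> where "\<forall>p\<in>topspace X. \<exists>g. \<iota> p \<in> I \<and> continuous_map X euclideanreal g \<and>
      (\<forall>x\<in>topspace X. g x \<ge> 0) \<and> g p > 0 \<and> (\<forall>x\<in>topspace X. g x > 0 \<longrightarrow> x \<in> U (\<iota> p))" ..
  from bchoice[OF this] obtain g where \<iota>: "\<And>p. p \<in> topspace X \<Longrightarrow> \<iota> p \<in> I"
    and g: "\<And>p. p \<in> topspace X \<Longrightarrow> continuous_map X euclideanreal (g p)"
      "\<And>p x. \<lbrakk>p \<in> topspace X; x \<in> topspace X\<rbrakk> \<Longrightarrow> g p x \<ge> (0::real)"
      "\<And>p. p \<in> topspace X \<Longrightarrow> g p p > 0"
      "\<And>p x. \<lbrakk>p \<in> topspace X; x \<in> topspace X; g p x > 0\<rbrakk> \<Longrightarrow> x \<in> U (\<iota> p)"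
    by blast
  let ?V = "\<lambda>p. {x \<in> topspace X. g p x \<in> {0<..}}"
  have "openin X (?V p)" if "p \<in> topspace X" for p
    using g(1)[OF that] by (rule openin_continuous_map_preimage) simp
  moreover have "topspace X \<subseteq> \<Union> (?V ` topspace X)" using g(3) by auto
  ultimately obtain \<F> where "finite \<F>" "\<F> \<subseteq> ?V ` topspace X" and sub: "topspace X \<subseteq> \<Union>\<F>"
    using assms(1) unfolding compact_space_alt by (metis (no_types, lifting) imageE)
  then obtain P where P: "finite P" "P \<subseteq> topspace X" and \<F>: "\<F> = ?V ` P"
    by (meson finite_subset_image)
  \<comment> \<open>The maximum changes nothing on \<open>X\<close>; it makes the function nonnegative on the whole type.\<close>
  define \<phi> where "\<phi> i x = (\<Sum>p\<in>{p\<in>P. \<iota> p = i}. max 0 (g p x))" for i x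
  show thesis
  proof
    show "continuous_map X euclideanreal (\<phi> i)" for i
      unfolding \<phi>_def using P g(1) by (intro continuous_intros) auto
    show "\<phi> i x \<ge> 0" for i x unfolding \<phi>_def by (intro sum_nonneg) simp
    show "x \<in> U i" if x: "x \<in> topspace X" and pos: "\<phi> i x > 0" for i x
    proof -
      have "\<exists>p\<in>{p\<in>P. \<iota> p = i}. max 0 (g p x) \<noteq> 0"
      proof (rule ccontr)
        assume "\<not> ?thesis"
        then have "\<phi> i x = 0" unfolding \<phi>_def by (intro sum.neutral) blast
        then show False using pos by simp
      qed
      then obtain p where "p \<in> P" "\<iota> p = i" "g p x > 0" by (auto simp: max_def split: if_splits)
      then show ?thesis using g(4)[of p x] P(2) x by auto
    qed
    show "\<exists>i\<in>I. \<phi> i x > 0" if x: "x \<in> topspace X" for x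
    proof -
      obtain p where p: "p \<in> P" "g p x > 0" using sub \<F> x by auto
      have "\<phi> (\<iota> p) x > 0"
        unfolding \<phi>_def using p P(1) by (intro sum_pos2[of _ p]) auto
      then show ?thesis using \<iota> p P(2) by blast
    qed
  qed
qed

text \<open>
  The factors \<open>\<phi> j\<close> serve the case \<open>J = I\<close>: no index remains to be dominated there, and without them
  the weight would be \<open>1\<close> everywhere, also where some \<open>\<phi> j\<close> with \<open>j \<in> J\<close> vanishes.
\<close>

definition dominance :: "('i \<Rightarrow> 'a \<Rightarrow> real) \<Rightarrow> 'i set \<Rightarrow> 'i set \<Rightarrow> 'a \<Rightarrow> real" where
  "dominance \<phi> I J x = (\<Prod>j\<in>J. \<phi> j x * (\<Prod>i\<in>I - J. max 0 (\<phi> j x - \<phi> i x)))"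

lemma dominance_nonzero_iff:
  assumes "finite I" "J \<subseteq> I"
  shows "dominance \<phi> I J x \<noteq> 0 \<longleftrightarrow> (\<forall>j\<in>J. \<phi> j x \<noteq> 0 \<and> (\<forall>i\<in>I - J. \<phi> i x < \<phi> j x))"
proof -
  have "max 0 (a - b) = 0 \<longleftrightarrow> \<not> b < a" for a b :: real by auto
  then show ?thesis using assms finite_subset[OF assms(2,1)] by (simp add: dominance_def)
qed

lemma continuous_map_dominance:
  assumes "finite I" "J \<subseteq> I" "\<And>i. continuous_map X euclideanreal (\<phi> i)"
  shows "continuous_map X euclideanreal (dominance \<phi> I J)"
  unfolding dominance_def using assms finite_subset[OF assms(2,1)]
  by (intro continuous_intros) auto

text \<open>
  Two different sets of the same finite size each contain an index that the other lacks, and each of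
  these two indices would have to dominate the other.
\<close>

lemma dominance_disjoint:
  assumes I: "finite I" and J: "J \<subseteq> I" "J' \<subseteq> I" "card J = card J'"
    and nz: "dominance \<phi> I J x \<noteq> 0" "dominance \<phi> I J' x \<noteq> 0"
  shows "J = J'"
proof (rule ccontr)
  assume "J \<noteq> J'"
  moreover have "finite J" "finite J'" using I J finite_subset by auto
  ultimately have "\<not> J \<subseteq> J'" "\<not> J' \<subseteq> J" using J(3) card_subset_eq by metis+
  then obtain j j' where "j \<in> J - J'" "j' \<in> J' - J" by blast
  then have "\<phi> j' x < \<phi> j x" "\<phi> j x < \<phi> j' x"
    using nz J by (auto simp: dominance_nonzero_iff[OF I])
  then show False by simp
qed

section \<open>The nowhere zero section\<close>

text \<open>
  The section of the summand responsible for the points where exactly \<open>k\<close> of the functions \<open>\<phi> i\<close>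
  are positive.
\<close>

lemma (in real_vector_bundle) exists_section_nonzero_at_depth:
  assumes I: "finite I" and k: "k \<ge> 1"
    and cont: "\<And>i. continuous_map X euclideanreal (\<phi> i)"
    and nonneg: "\<And>i x. \<phi> i x \<ge> (0::real)"
    and supp: "\<And>i x. \<lbrakk>x \<in> topspace X; \<phi> i x > 0\<rbrakk> \<Longrightarrow> x \<in> U i"
    and sec: "\<And>i. i \<in> I \<Longrightarrow> \<exists>s. bundle_section X \<xi> s \<and> section_zeros X \<xi> s \<inter> U i = {}"
  shows "\<exists>s. bundle_section X \<xi> s \<and>
           (\<forall>x\<in>topspace X. card {i\<in>I. \<phi> i x > 0} = k \<longrightarrow> s x \<noteq> fib_zero \<xi> x)"
proof -
  obtain t where t: "\<And>i. i \<in> I \<Longrightarrow> bundle_section X \<xi> (t i)"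
    "\<And>i. i \<in> I \<Longrightarrow> section_zeros X \<xi> (t i) \<inter> U i = {}"
    using sec by metis
  define A where "A = {J. J \<subseteq> I \<and> card J = k}"
  have "J \<noteq> {}" if "J \<in> A" for J using that k by (auto simp: A_def)
  then obtain \<iota> where \<iota>: "\<And>J. J \<in> A \<Longrightarrow> \<iota> J \<in> J" by (metis ex_in_conv)
  have A: "finite A" "\<And>J. J \<in> A \<Longrightarrow> J \<subseteq> I" "\<And>J. J \<in> A \<Longrightarrow> \<iota> J \<in> I"
    using I \<iota> by (auto simp: A_def)
  have "\<exists>s. bundle_section X \<xi> s \<and>
      (\<forall>x\<in>topspace X. (\<forall>J\<in>A. dominance \<phi> I J x \<noteq> 0 \<longrightarrow>
                            s x = fib_scale \<xi> (dominance \<phi> I J x) (t (\<iota> J) x)) \<and>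
                      ((\<forall>J\<in>A. dominance \<phi> I J x = 0) \<longrightarrow> s x = fib_zero \<xi> x))"
  proof (rule disjointly_weighted_section)
    show "J = J'" if "J \<in> A" "J' \<in> A" "dominance \<phi> I J x \<noteq> 0" "dominance \<phi> I J' x \<noteq> 0" for J J' x
      using dominance_disjoint[OF I _ _ _ that(3,4)] that(1,2) by (auto simp: A_def)
  qed (use A t(1) continuous_map_dominance[OF I A(2) cont] in auto)
  then obtain s where s: "bundle_section X \<xi> s"
    and s_eq: "\<And>x J. \<lbrakk>x \<in> topspace X; J \<in> A; dominance \<phi> I J x \<noteq> 0\<rbrakk> \<Longrightarrow>
           s x = fib_scale \<xi> (dominance \<phi> I J x) (t (\<iota> J) x)"
    by blast
  have "s x \<noteq> fib_zero \<xi> x" if x: "x \<in> topspace X" and card: "card {i\<in>I. \<phi> i x > 0} = k" for x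
  proof -
    let ?J = "{i\<in>I. \<phi> i x > 0}"
    have J: "?J \<in> A" using card by (simp add: A_def)
    have dom: "dominance \<phi> I ?J x \<noteq> 0"
      using nonneg[of _ x] by (subst dominance_nonzero_iff[OF I]) (auto simp: not_less intro: le_less_trans)
    have "\<phi> (\<iota> ?J) x > 0" using \<iota>[OF J] by simp
    then have "t (\<iota> ?J) x \<noteq> fib_zero \<xi> x"
      using t(2)[OF A(3)[OF J]] supp x by (auto simp: section_zeros_def)
    then show ?thesis
      using s_eq[OF x J dom] dom bundle_section_in_fibre[OF t(1)[OF A(3)[OF J]] x]
        real_vector_space_on.scale_eq_zero_iff[OF fibre_vector_space[OF x]] by simp
  qed
  then show ?thesis using s by blast
qed

theorem theorem2p1:
  fixes X :: "'a topology"
    and n :: nat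
    and \<xi> :: "nat \<Rightarrow> ('a, 'e) vbundle"
    and I :: "'i set"
    and U :: "'i \<Rightarrow> 'a set"
  assumes "compact_space X" and "Hausdorff_space X"
    and "n \<ge> 1"
    and "\<And>k. k \<in> {1..n} \<Longrightarrow> real_vector_bundle X (\<xi> k)"
    and "finite I"
    and "\<And>i. i \<in> I \<Longrightarrow> openin X (U i)"
    and "(\<Union>i\<in>I. U i) = topspace X"
    and "\<And>x. x \<in> topspace X \<Longrightarrow> card {i \<in> I. x \<in> U i} \<le> n"
    and "\<And>i k. \<lbrakk>i \<in> I; k \<in> {1..n}\<rbrakk> \<Longrightarrow>
           \<exists>s. bundle_section X (\<xi> k) s \<and> section_zeros X (\<xi> k) s \<inter> U i = {}"
  shows "\<exists>s. bundle_section X (whitney_sum X {1..n} \<xi>) s \<and>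
           section_zeros X (whitney_sum X {1..n} \<xi>) s = {}"
proof -
  obtain \<phi> :: "'i \<Rightarrow> 'a \<Rightarrow> real" where cont: "\<And>i. continuous_map X euclideanreal (\<phi> i)"
    and nonneg: "\<And>i x. \<phi> i x \<ge> 0"
    and supp: "\<And>i x. \<lbrakk>x \<in> topspace X; \<phi> i x > 0\<rbrakk> \<Longrightarrow> x \<in> U i"
    and pos: "\<And>x. x \<in> topspace X \<Longrightarrow> \<exists>i\<in>I. \<phi> i x > 0"
    using exists_subordinate_bump_functions[OF assms(1,2,6,7)] by blast
  let ?J = "\<lambda>x. {i\<in>I. \<phi> i x > 0}"
  have "\<exists>s. bundle_section X (\<xi> k) s \<and>
          (\<forall>x\<in>topspace X. card (?J x) = k \<longrightarrow> s x \<noteq> fib_zero (\<xi> k) x)" if k: "k \<in> {1..n}" for k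
    using k by (intro real_vector_bundle.exists_section_nonzero_at_depth[OF assms(4)[OF k] assms(5)
          _ cont nonneg supp assms(9)[OF _ k]]) auto
  then have "\<forall>k\<in>{1..n}. \<exists>s. bundle_section X (\<xi> k) s \<and>
          (\<forall>x\<in>topspace X. card (?J x) = k \<longrightarrow> s x \<noteq> fib_zero (\<xi> k) x)"
    by blast
  from bchoice[OF this] obtain s where s: "\<And>k. k \<in> {1..n} \<Longrightarrow> bundle_section X (\<xi> k) (s k)"
    and nz: "\<And>k x. \<lbrakk>k \<in> {1..n}; x \<in> topspace X; card (?J x) = k\<rbrakk> \<Longrightarrow> s k x \<noteq> fib_zero (\<xi> k) x"
    by blast
  let ?s = "\<lambda>x. (x, \<lambda>k\<in>{1..n}. s k x)"
  have "?s x \<noteq> fib_zero (whitney_sum X {1..n} \<xi>) x" if x: "x \<in> topspace X" for x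
  proof -
    have "card (?J x) \<le> card {i\<in>I. x \<in> U i}"
      using assms(5) supp[OF x] by (intro card_mono) auto
    then have "card (?J x) \<le> n" using assms(8)[OF x] by simp
    moreover have "card (?J x) > 0" using pos[OF x] assms(5) by (auto simp: card_gt_0_iff)
    ultimately have k: "card (?J x) \<in> {1..n}" by simp
    show ?thesis
    proof
      assume "?s x = fib_zero (whitney_sum X {1..n} \<xi>) x"
      then have "(\<lambda>k\<in>{1..n}. s k x) = (\<lambda>k\<in>{1..n}. fib_zero (\<xi> k) x)"
        by (simp add: whitney_sum_def)
      from fun_cong[OF this, of "card (?J x)"] show False
        using nz[OF k x refl] k by simp
    qed
  qed
  then have "section_zeros X (whitney_sum X {1..n} \<xi>) ?s = {}"
    by (auto simp: section_zeros_def)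
  then show ?thesis using bundle_section_whitney_sum[of "{1..n}" X \<xi> s] s by blast
qed

end
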